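(* Let $\mathbf{k}$ be a field of characteristic $0$ and let $(A,\mu,\alpha)$ be a Hom-algebra over $\mathbf{k}$. Then $A$ is an $A_3$-Hom-associative algebra if and only if it is both a third Hom-power associative algebra and a Hom-Lie admissible algebra.
   Context: A Hom-algebra $(A,\mu,\alpha)$ over $\mathbf{k}$ is a $\mathbf{k}$-vector space $A$ with a bilinear map $\mu\colon A^{\otimes 2}\to A$ (no associativity assumed; write $xy=\mu(x,y)$) and a linear map $\alpha\colon A\to A$ (not assumed multiplicative). The Hom-associator is $as_A(x,y,z)=(xy)\alpha(z)-\alpha(x)(yz)$. For a subgroup $G$ of $S_3$, $A$ is $G$-Hom-associative if $\sum_{\sigma\in G}(-1)^{\varepsilon(\sigma)}as_A\circ\sigma=0$, where $S_3$ acts on $A^{\otimes 3}$ by permuting tensor factors and $(-1)^{\varepsilon(\sigma)}$ is the sign. Here $A_3=\{Id,\pi,\pi^2\}$ with $\pi=(1~2~3)$. $A$ is third Hom-power associative if $x^3=\alpha^{2-i}(x^i)\,\alpha^{i-1}(x^{3-i})$ for all $x\in A$ and $i\in\{1,2\}$, where $x^1=x$, $x^2=xx$, $x^3=x^2\alpha(x)$, $\alpha^0=Id$. The commutator is $[x,y]=xy-yx$. $A$ is Hom-Lie admissible if $(A,[,],\alpha)$ is a Hom-Lie algebra, i.e. $[[x,y],\alpha(z)]+[[z,x],\alpha(y)]+[[y,z],\alpha(x)]=0$ for all $x,y,z\in A$. (A Hom-Lie algebra is a Hom-algebra whose multiplication $\mu$ is anti-symmetric and satisfies $(xy)\alpha(z)+(zx)\alpha(y)+(yz)\alpha(x)=0$.)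 *)

theory Defs
  imports Complex_Main "HOL-Algebra.Sym_Groups"
begin

text \<open>The underlying vector space is the whole type \<^typ>\<open>'a\<close>, with scalar multiplication \<open>scale\<close>.\<close>

locale hom_algebra = vector_space scale
  for scale :: "'k::field \<Rightarrow> 'a::ab_group_add \<Rightarrow> 'a"
    and \<mu> :: "'a \<Rightarrow> 'a \<Rightarrow> 'a"
    and \<alpha> :: "'a \<Rightarrow> 'a" +
  assumes linear_left: "Vector_Spaces.linear scale scale (\<lambda>x. \<mu> x y)"
    and linear_right: "Vector_Spaces.linear scale scale (\<lambda>y. \<mu> x y)"
    and linear_twist: "Vector_Spaces.linear scale scale \<alpha>"

definition hom_associator ::
    "('a::ab_group_add \<Rightarrow> 'a \<Rightarrow> 'a) \<Rightarrow> ('a \<Rightarrow> 'a) \<Rightarrow> 'a \<Rightarrow> 'a \<Rightarrow> 'a \<Rightarrow> 'a" where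
  "hom_associator \<mu> \<alpha> x y z = \<mu> (\<mu> x y) (\<alpha> z) - \<mu> (\<alpha> x) (\<mu> y z)"

text \<open>
  Meant for a subgroup \<open>G\<close> of the symmetric group on \<open>{1..3}\<close>.  An identity between linear maps on
  the third tensor power is stated by evaluating both sides on all pure tensors
  \<open>x 1 \<otimes> x 2 \<otimes> x 3\<close>; only the values of \<open>x\<close> at \<open>1\<close>, \<open>2\<close>, \<open>3\<close> matter.  The convention used for
  the action sends this tensor to \<open>x (\<sigma> 1) \<otimes> x (\<sigma> 2) \<otimes> x (\<sigma> 3)\<close>; using the inverse of \<open>\<sigma>\<close>
  instead gives the same sum, as \<open>G\<close> is closed under inverses and these preserve the sign.
\<close>

definition G_hom_associative ::
    "(nat \<Rightarrow> nat) set \<Rightarrow> ('k::field \<Rightarrow> 'a::ab_group_add \<Rightarrow> 'a)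
      \<Rightarrow> ('a \<Rightarrow> 'a \<Rightarrow> 'a) \<Rightarrow> ('a \<Rightarrow> 'a) \<Rightarrow> bool" where
  "G_hom_associative G scale \<mu> \<alpha> \<longleftrightarrow>
    (\<forall>x :: nat \<Rightarrow> 'a.
      (\<Sum>\<sigma>\<in>G. scale (of_int (sign \<sigma>)) (hom_associator \<mu> \<alpha> (x (\<sigma> 1)) (x (\<sigma> 2)) (x (\<sigma> 3)))) = 0)"

definition cycle123 :: "nat \<Rightarrow> nat" where
  "cycle123 = cycle_of_list [1, 2, 3]"

definition A3 :: "(nat \<Rightarrow> nat) set" where
  "A3 = {id, cycle123, cycle123 \<circ> cycle123}"

lemma cycle123_simps: "cycle123 1 = 2" "cycle123 2 = 3" "cycle123 3 = 1"
  by (simp_all add: cycle123_def transpose_def)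

lemma subgroup_A3: "subgroup A3 (sym_group 3)"
proof -
  have p: "cycle123 permutes {1..3}"
    unfolding cycle123_def by (rule permutes_subset[OF cycle_permutes]) auto
  have c3: "cycle123 \<circ> cycle123 \<circ> cycle123 = id"
    by (auto simp: fun_eq_iff cycle123_def transpose_def)
  have c3': "cycle123 \<circ> (cycle123 \<circ> cycle123) = id"
    using c3 by (simp add: comp_assoc)
  have c4: "cycle123 \<circ> cycle123 \<circ> (cycle123 \<circ> cycle123) = cycle123"
    using c3 by (metis comp_assoc comp_id)
  have mem: "g \<in> carrier (sym_group 3)" if "g \<in> A3" for g
    using that p by (auto simp: A3_def sym_group_def permutes_id intro: permutes_compose)
  interpret group "sym_group 3" by (rule sym_group_is_group)
  show ?thesis
  proof (rule subgroupI)
    show "A3 \<subseteq> carrier (sym_group 3)" using mem by blast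
    show "A3 \<noteq> {}" by (simp add: A3_def)
    show "a \<otimes>\<^bsub>sym_group 3\<^esub> b \<in> A3" if "a \<in> A3" "b \<in> A3" for a b
      using that c3 c3' c4 by (auto simp: A3_def sym_group_def)
    show "inv\<^bsub>sym_group 3\<^esub> a \<in> A3" if a: "a \<in> A3" for a
    proof -
      have "\<exists>b\<in>A3. b \<circ> a = id"
      proof -
        consider "a = id" | "a = cycle123" | "a = cycle123 \<circ> cycle123" using a unfolding A3_def by blast
        then show ?thesis
        proof cases
          case 1 then show ?thesis by (intro bexI[of _ id]) (simp_all add: A3_def)
        next
          case 2 show ?thesis unfolding 2 by (rule bexI[where x = "cycle123 \<circ> cycle123"], rule c3, simp add: A3_def)
        next
          case 3 show ?thesis unfolding 3 by (rule bexI[where x = cycle123], rule c3', simp add: A3_def)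
        qed
      qed
      then obtain b where b: "b \<in> A3" "b \<circ> a = id" by blast
      then have "inv\<^bsub>sym_group 3\<^esub> a = b"
        using inv_equality[of b a] mem[OF a] mem[OF b(1)] by (simp only: sym_group_mult sym_group_one)
      with b show ?thesis by simp
    qed
  qed
qed

text \<open>
  The Hom-powers \<open>x^1 = x\<close> and \<open>x^(n+2) = x^(n+1) \<alpha>^n(x)\<close>; exponent \<open>0\<close> has no meaning
  and is given a dummy value.
\<close>

fun hom_power :: "('a \<Rightarrow> 'a \<Rightarrow> 'a) \<Rightarrow> ('a \<Rightarrow> 'a) \<Rightarrow> 'a \<Rightarrow> nat \<Rightarrow> 'a" where
  "hom_power \<mu> \<alpha> x 0 = x"
| "hom_power \<mu> \<alpha> x (Suc 0) = x"
| "hom_power \<mu> \<alpha> x (Suc (Suc n)) = \<mu> (hom_power \<mu> \<alpha> x (Suc n)) ((\<alpha> ^^ n) x)"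

lemma hom_power_upto_3:
  "hom_power \<mu> \<alpha> x 1 = x"
  "hom_power \<mu> \<alpha> x 2 = \<mu> x x"
  "hom_power \<mu> \<alpha> x 3 = \<mu> (\<mu> x x) (\<alpha> x)"
  by (simp_all add: numeral_2_eq_2 numeral_3_eq_3)

definition third_hom_power_associative :: "('a \<Rightarrow> 'a \<Rightarrow> 'a) \<Rightarrow> ('a \<Rightarrow> 'a) \<Rightarrow> bool" where
  "third_hom_power_associative \<mu> \<alpha> \<longleftrightarrow>
    (\<forall>x. \<forall>i\<in>{1, 2}.
      hom_power \<mu> \<alpha> x 3 =
        \<mu> ((\<alpha> ^^ (2 - i)) (hom_power \<mu> \<alpha> x i)) ((\<alpha> ^^ (i - 1)) (hom_power \<mu> \<alpha> x (3 - i))))"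

locale hom_Lie_algebra = hom_algebra +
  assumes antisymmetric: "\<mu> x y = - \<mu> y x"
    and hom_Jacobi: "\<mu> (\<mu> x y) (\<alpha> z) + \<mu> (\<mu> z x) (\<alpha> y) + \<mu> (\<mu> y z) (\<alpha> x) = 0"

definition hom_commutator :: "('a::ab_group_add \<Rightarrow> 'a \<Rightarrow> 'a) \<Rightarrow> 'a \<Rightarrow> 'a \<Rightarrow> 'a" where
  "hom_commutator \<mu> x y = \<mu> x y - \<mu> y x"

definition hom_Lie_admissible ::
    "('k::field \<Rightarrow> 'a::ab_group_add \<Rightarrow> 'a) \<Rightarrow> ('a \<Rightarrow> 'a \<Rightarrow> 'a) \<Rightarrow> ('a \<Rightarrow> 'a) \<Rightarrow> bool" where
  "hom_Lie_admissible scale \<mu> \<alpha> \<longleftrightarrow> hom_Lie_algebra scale (hom_commutator \<mu>) \<alpha>"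

end

theory Submission
  imports Defs
begin

text \<open>
  Write \<open>C(x, y, z)\<close> for the sum of the Hom-associator over the cyclic rotations of \<open>(x, y, z)\<close>.
  All permutations in \<open>A3\<close> are even, so \<open>A3\<close>-Hom-associativity says \<open>C = 0\<close>.  The other two
  conditions are the alternating and the symmetric half of this equation under exchange of two
  arguments.

  Expanding the twelve terms of the Hom-Jacobi sum of the commutator gives
  \<open>C(x, y, z) - C(y, x, z)\<close> (\<open>hom_Jacobi_commutator\<close>), so Hom-Lie admissibility says that
  \<open>C\<close> is symmetric.  Third Hom-power associativity says that the Hom-associator vanishes on the
  diagonal; as it is additive in each argument, polarisation (\<open>polarise_cubic\<close>) turns this into
  \<open>C(x, y, z) + C(y, x, z) = 0\<close>.  Both together give \<open>2 C = 0\<close>, hence \<open>C = 0\<close> as \<open>2\<close> is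
  invertible.  Conversely, \<open>C = 0\<close> makes the Hom-Jacobi sum vanish, and
  \<open>C(x, x, x)\<close> is three times the Hom-associator at \<open>(x, x, x)\<close>, where \<open>3\<close> is invertible.
\<close>

definition cyclic_associator ::
    "('a::ab_group_add \<Rightarrow> 'a \<Rightarrow> 'a) \<Rightarrow> ('a \<Rightarrow> 'a) \<Rightarrow> 'a \<Rightarrow> 'a \<Rightarrow> 'a \<Rightarrow> 'a" where
  "cyclic_associator \<mu> \<alpha> x y z =
    hom_associator \<mu> \<alpha> x y z + hom_associator \<mu> \<alpha> y z x + hom_associator \<mu> \<alpha> z x y"

text \<open>
  Inclusion-exclusion: in \<open>T(s, s, s)\<close> with \<open>s = x + y + z\<close>, the terms that miss one of
  \<open>x\<close>, \<open>y\<close>, \<open>z\<close> are cancelled by the diagonal values at the partial sums, and what remains is the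
  sum over all orderings.
\<close>

lemma polarise_cubic:
  fixes T :: "'a::ab_semigroup_add \<Rightarrow> 'a \<Rightarrow> 'a \<Rightarrow> 'b::ab_group_add"
  assumes add1: "\<And>x x' y z. T (x + x') y z = T x y z + T x' y z"
    and add2: "\<And>x y y' z. T x (y + y') z = T x y z + T x y' z"
    and add3: "\<And>x y z z'. T x y (z + z') = T x y z + T x y z'"
    and diagonal: "\<And>x. T x x x = 0"
  shows "T x y z + T y z x + T z x y + (T y x z + T x z y + T z y x) = 0"
proof -
  have "T x y z + T y z x + T z x y + (T y x z + T x z y + T z y x) =
      T (x + y + z) (x + y + z) (x + y + z)
        - T (x + y) (x + y) (x + y) - T (y + z) (y + z) (y + z) - T (x + z) (x + z) (x + z)
        + T x x x + T y y y + T z z z"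
    by (simp only: add1 add2 add3) (simp add: algebra_simps)
  then show ?thesis by (simp only: diagonal) simp
qed

lemma cycle123_eq_transpositions: "cycle123 = transpose 1 2 \<circ> transpose 2 3"
  by (simp add: cycle123_def fun_eq_iff)

lemma sign_cycle123: "sign cycle123 = 1"
  unfolding cycle123_eq_transpositions
  by (subst sign_compose; simp only: permutation_swap_id sign_swap_id) simp

lemma sign_cycle123_square: "sign (cycle123 \<circ> cycle123) = 1"
proof -
  have "permutation cycle123"
    unfolding cycle123_eq_transpositions by (intro permutation_compose permutation_swap_id)
  then show ?thesis by (simp add: sign_compose sign_cycle123)
qed

lemma sum_A3: "sum f A3 = f id + f cycle123 + f (cycle123 \<circ> cycle123)"
proof -
  have "id \<noteq> cycle123" "id \<noteq> cycle123 \<circ> cycle123" "cycle123 \<noteq> cycle123 \<circ> cycle123"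
    using cycle123_simps by (auto dest!: fun_cong[of _ _ 1])
  then show ?thesis unfolding A3_def by (simp add: add.assoc)
qed

text \<open>
  The identity for \<open>i = 1\<close> reads \<open>(xx)\<alpha>(x) = \<alpha>(x)(xx)\<close>; for \<open>i = 2\<close> both sides are
  \<open>(xx)\<alpha>(x)\<close>.
\<close>

lemma third_hom_power_associative_iff:
  "third_hom_power_associative \<mu> \<alpha> \<longleftrightarrow> (\<forall>x. hom_associator \<mu> \<alpha> x x x = 0)"
  by (simp add: third_hom_power_associative_def hom_associator_def
      numeral_2_eq_2 numeral_3_eq_3)

context hom_algebra
begin

lemma mult_simps:
  "\<mu> (x + x') y = \<mu> x y + \<mu> x' y" "\<mu> x (y + y') = \<mu> x y + \<mu> x y'"
  "\<mu> (x - x') y = \<mu> x y - \<mu> x' y" "\<mu> x (y - y') = \<mu> x y - \<mu> x y'"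
  "\<mu> (scale c x) y = scale c (\<mu> x y)" "\<mu> x (scale c y) = scale c (\<mu> x y)"
  "\<alpha> (x + x') = \<alpha> x + \<alpha> x'"
proof -
  interpret left: Vector_Spaces.linear scale scale "\<lambda>x. \<mu> x y" for y by (rule linear_left)
  interpret right: Vector_Spaces.linear scale scale "\<mu> x" for x by (rule linear_right)
  interpret twist: Vector_Spaces.linear scale scale \<alpha> by (rule linear_twist)
  show "\<mu> (x + x') y = \<mu> x y + \<mu> x' y" "\<mu> x (y + y') = \<mu> x y + \<mu> x y'"
    "\<mu> (x - x') y = \<mu> x y - \<mu> x' y" "\<mu> x (y - y') = \<mu> x y - \<mu> x y'"
    "\<mu> (scale c x) y = scale c (\<mu> x y)" "\<mu> x (scale c y) = scale c (\<mu> x y)"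
    "\<alpha> (x + x') = \<alpha> x + \<alpha> x'"
    by (rule left.add right.add left.diff right.diff left.scale right.scale twist.add)+
qed

lemma hom_associator_add:
  "hom_associator \<mu> \<alpha> (x + x') y z = hom_associator \<mu> \<alpha> x y z + hom_associator \<mu> \<alpha> x' y z"
  "hom_associator \<mu> \<alpha> x (y + y') z = hom_associator \<mu> \<alpha> x y z + hom_associator \<mu> \<alpha> x y' z"
  "hom_associator \<mu> \<alpha> x y (z + z') = hom_associator \<mu> \<alpha> x y z + hom_associator \<mu> \<alpha> x y z'"
  by (simp_all add: hom_associator_def mult_simps)

lemma A3_hom_associative_iff:
  "G_hom_associative A3 scale \<mu> \<alpha> \<longleftrightarrow> (\<forall>x y z. cyclic_associator \<mu> \<alpha> x y z = 0)"
proof -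
  have "G_hom_associative A3 scale \<mu> \<alpha> \<longleftrightarrow>
      (\<forall>x :: nat \<Rightarrow> 'a. cyclic_associator \<mu> \<alpha> (x 1) (x 2) (x 3) = 0)"
    unfolding G_hom_associative_def sum_A3 cyclic_associator_def sign_cycle123 sign_cycle123_square
      sign_id o_apply id_apply cycle123_simps of_int_1 scale_one ..
  also have "\<dots> \<longleftrightarrow> (\<forall>x y z. cyclic_associator \<mu> \<alpha> x y z = 0)"
  proof (intro iffI allI)
    fix x y z
    assume vanish: "\<forall>x :: nat \<Rightarrow> 'a. cyclic_associator \<mu> \<alpha> (x 1) (x 2) (x 3) = 0"
    show "cyclic_associator \<mu> \<alpha> x y z = 0"
      using spec[OF vanish, of "(\<lambda>_. z)(1 := x, 2 := y)"] by simp
  qed simp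
  finally show ?thesis .
qed

text \<open>
  Each of the six orderings of the arguments contributes two of the twelve products on the left,
  which make up its Hom-associator with the sign of the ordering.
\<close>

lemma hom_Jacobi_commutator:
  "hom_commutator \<mu> (hom_commutator \<mu> x y) (\<alpha> z)
      + hom_commutator \<mu> (hom_commutator \<mu> z x) (\<alpha> y)
      + hom_commutator \<mu> (hom_commutator \<mu> y z) (\<alpha> x)
    = cyclic_associator \<mu> \<alpha> x y z - cyclic_associator \<mu> \<alpha> y x z"
  by (simp add: hom_commutator_def cyclic_associator_def hom_associator_def mult_simps)

lemma hom_algebra_commutator: "hom_algebra scale (hom_commutator \<mu>) \<alpha>"
proof (intro hom_algebra.intro hom_algebra_axioms.intro)
  show "Vector_Spaces.linear scale scale (\<lambda>x. hom_commutator \<mu> x y)"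
    "Vector_Spaces.linear scale scale (\<lambda>x. hom_commutator \<mu> y x)" for y
    by (unfold_locales; simp add: hom_commutator_def mult_simps scale_right_diff_distrib)+
qed (rule vector_space_axioms linear_twist)+

lemma hom_Lie_admissible_iff:
  "hom_Lie_admissible scale \<mu> \<alpha> \<longleftrightarrow>
    (\<forall>x y z. cyclic_associator \<mu> \<alpha> x y z = cyclic_associator \<mu> \<alpha> y x z)"
  unfolding hom_Lie_admissible_def hom_Lie_algebra_def hom_Lie_algebra_axioms_def
    hom_Jacobi_commutator
  using hom_algebra_commutator by (simp add: hom_commutator_def)

lemma cyclic_associator_skew:
  assumes "third_hom_power_associative \<mu> \<alpha>"
  shows "cyclic_associator \<mu> \<alpha> x y z + cyclic_associator \<mu> \<alpha> y x z = 0"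
  unfolding cyclic_associator_def
  using assms hom_associator_add
  by (intro polarise_cubic) (simp_all add: third_hom_power_associative_iff)

end

theorem theorem3p9:
  fixes scale :: "'k::field_char_0 \<Rightarrow> 'a::ab_group_add \<Rightarrow> 'a"
    and \<mu> :: "'a \<Rightarrow> 'a \<Rightarrow> 'a"
    and \<alpha> :: "'a \<Rightarrow> 'a"
  assumes "hom_algebra scale \<mu> \<alpha>"
  shows "G_hom_associative A3 scale \<mu> \<alpha> \<longleftrightarrow>
    third_hom_power_associative \<mu> \<alpha> \<and> hom_Lie_admissible scale \<mu> \<alpha>"
proof -
  interpret hom_algebra scale \<mu> \<alpha> by (rule assms)
  show ?thesis
  proof
    assume "G_hom_associative A3 scale \<mu> \<alpha>"
    then have zero: "cyclic_associator \<mu> \<alpha> x y z = 0" for x y z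
      by (simp add: A3_hom_associative_iff)
    have "hom_associator \<mu> \<alpha> x x x = 0" for x
    proof -
      let ?a = "hom_associator \<mu> \<alpha> x x x"
      have "scale 3 ?a = scale (1 + 1 + 1) ?a" by simp
      also have "\<dots> = cyclic_associator \<mu> \<alpha> x x x"
        by (simp only: scale_left_distrib scale_one cyclic_associator_def)
      finally show ?thesis using zero by simp
    qed
    then show "third_hom_power_associative \<mu> \<alpha> \<and> hom_Lie_admissible scale \<mu> \<alpha>"
      by (simp add: third_hom_power_associative_iff hom_Lie_admissible_iff zero)
  next
    assume both: "third_hom_power_associative \<mu> \<alpha> \<and> hom_Lie_admissible scale \<mu> \<alpha>"
    have "cyclic_associator \<mu> \<alpha> x y z = 0" for x y z
    proof -
      let ?c = "cyclic_associator \<mu> \<alpha> x y z"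
      have "scale 2 ?c = scale (1 + 1) ?c" by simp
      also have "\<dots> = ?c + ?c" by (simp only: scale_left_distrib scale_one)
      also have "\<dots> = ?c + cyclic_associator \<mu> \<alpha> y x z"
        using both by (simp add: hom_Lie_admissible_iff)
      also have "\<dots> = 0" using both cyclic_associator_skew by blast
      finally show ?thesis by simp
    qed
    then show "G_hom_associative A3 scale \<mu> \<alpha>" by (simp add: A3_hom_associative_iff)
  qed
qed

end
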